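(* Let $d\ge 1$ and let $\mathbb{T}=(T_{ij})$ be a $d\times d$ operator matrix where $T_{ij}\in\mathcal{B}_A(\mathcal{H})$ for all $i,j\in\{1,\dots,d\}$, regarded as an operator on $\mathbb{H}=\oplus_{i=1}^d\mathcal{H}$. Then $$\omega_{\mathbb{A}}(\mathbb{T})\leq \max_{i\in\{1,\dots,d\}}\omega_A(T_{ii})+\frac{1}{2}\sum_{i=1}^{d}\sqrt{\left\|\sum_{j=1,\,j\neq i}^{d}T_{ij}T_{ij}^{\sharp_A}\right\|_A}.$$
   Context: $(\mathcal{H},\langle\cdot\mid\cdot\rangle)$ is a non-trivial complex Hilbert space, $\mathcal{B}(\mathcal{H})$ is the algebra of bounded linear operators on $\mathcal{H}$, and $A\in\mathcal{B}(\mathcal{H})$ is a fixed nonzero positive (semidefinite) operator. Put $\langle x\mid y\rangle_A=\langle Ax\mid y\rangle$ and $\|x\|_A=\langle x\mid x\rangle_A^{1/2}$. An operator $T\in\mathcal{B}(\mathcal{H})$ is $A$-bounded, written $T\in\mathcal{B}_{A^{1/2}}(\mathcal{H})$, if there is $\lambda>0$ with $\|Tx\|_A\le\lambda\|x\|_A$ for all $x\in\mathcal{H}$. For such $T$, $\|T\|_A=\sup\{\|Tx\|_A : x\in\mathcal{H},\ \|x\|_A=1\}$ and the $A$-numerical radius is $\omega_A(T)=\sup\{|\langle Tx\mid x\rangle_A| : x\in\mathcal{H},\ \|x\|_A=1\}$. $\mathcal{B}_A(\mathcal{H})$ is the set of $T\in\mathcal{B}(\mathcal{H})$ for which the equation $AX=T^*A$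 has a solution $X\in\mathcal{B}(\mathcal{H})$ (equivalently $\mathcal{R}(T^*A)\subset\mathcal{R}(A)$, where $\mathcal{R}$ denotes range); one has $\mathcal{B}_A(\mathcal{H})\subseteq\mathcal{B}_{A^{1/2}}(\mathcal{H})$. For $T\in\mathcal{B}_A(\mathcal{H})$, $T^{\sharp_A}$ denotes the unique solution $X\in\mathcal{B}(\mathcal{H})$ of $AX=T^*A$ with $\mathcal{R}(X)\subseteq\overline{\mathcal{R}(A)}$. $\mathbb{H}=\oplus_{i=1}^d\mathcal{H}$ has the inner product $\langle x,y\rangle=\sum_{k=1}^d\langle x_k\mid y_k\rangle$, and $\mathbb{A}$ is the $d\times d$ diagonal operator matrix on $\mathbb{H}$ with every diagonal entry equal to $A$. $\omega_{\mathbb{A}}$ is the notion above with $(\mathbb{H},\mathbb{A})$ in place of $(\mathcal{H},A)$. *)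

theory Defs
  imports "HOL-Analysis.Analysis"
begin

subsection \<open>Complex Hilbert spaces\<close>

text \<open>
  HOL-Analysis only has real inner product spaces. A complex Hilbert space is a complete one
  that carries a complex scalar multiplication and a sesquilinear form, linear in the first
  argument, whose real part is the underlying real inner product. Norm and topology are therefore
  those induced by the complex inner product (see \<open>cinner_self\<close>), and the results of HOL-Analysis
  apply.
\<close>

class complex_hilbert_space = real_inner + complete_space +
  fixes scaleC :: "complex \<Rightarrow> 'a \<Rightarrow> 'a"  (infixr \<open>*\<^sub>C\<close> 75)
    and cinner :: "'a \<Rightarrow> 'a \<Rightarrow> complex"
  assumes scaleC_add_right: "c *\<^sub>C (x + y) = c *\<^sub>C x + c *\<^sub>C y"
    and scaleC_add_left: "(c + c') *\<^sub>C x = c *\<^sub>C x + c' *\<^sub>C x"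
    and scaleC_scaleC: "c *\<^sub>C (c' *\<^sub>C x) = (c * c') *\<^sub>C x"
    and scaleR_scaleC: "scaleR r x = complex_of_real r *\<^sub>C x"
    and cinner_commute: "cinner x y = cnj (cinner y x)"
    and cinner_add_left: "cinner (x + y) z = cinner x z + cinner y z"
    and cinner_scaleC_left: "cinner (c *\<^sub>C x) y = c * cinner x y"
    and Re_cinner: "Re (cinner x y) = inner x y"

lemma cinner_self: "cinner x x = complex_of_real ((norm x)\<^sup>2)"
  for x :: "'a::complex_hilbert_space"
proof (rule complex_eqI)
  show "Re (cinner x x) = Re (complex_of_real ((norm x)\<^sup>2))"
    by (simp add: Re_cinner power2_norm_eq_inner)
  show "Im (cinner x x) = Im (complex_of_real ((norm x)\<^sup>2))"
    using arg_cong[OF cinner_commute[of x x], of Im] by simp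
qed

instantiation complex :: complex_hilbert_space
begin

definition "scaleC_complex (c::complex) (x::complex) = c * x"
definition "cinner_complex (x::complex) (y::complex) = x * cnj y"

instance
  by standard
    (simp_all add: scaleC_complex_def cinner_complex_def algebra_simps scaleR_conv_of_real
      inner_complex_def)

end

text \<open>The direct sum of \<open>d\<close> copies of a space is \<open>'a ^ 'd\<close>, with \<open>d = CARD('d)\<close>.\<close>

instantiation vec :: (complex_hilbert_space, finite) complex_hilbert_space
begin

definition "scaleC_vec c (x :: 'a ^ 'b) = (\<chi> i. c *\<^sub>C (x $ i))"
definition "cinner_vec (x :: 'a ^ 'b) y = (\<Sum>i\<in>UNIV. cinner (x $ i) (y $ i))"

instance
proof
  fix c c' :: complex and r :: real and x y z :: "'a ^ 'b"
  show "c *\<^sub>C (x + y) = c *\<^sub>C x + c *\<^sub>C y"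
    by (simp add: vec_eq_iff scaleC_vec_def scaleC_add_right)
  show "(c + c') *\<^sub>C x = c *\<^sub>C x + c' *\<^sub>C x"
    by (simp add: vec_eq_iff scaleC_vec_def scaleC_add_left)
  show "c *\<^sub>C (c' *\<^sub>C x) = (c * c') *\<^sub>C x"
    by (simp add: vec_eq_iff scaleC_vec_def scaleC_scaleC)
  show "scaleR r x = complex_of_real r *\<^sub>C x"
    by (simp add: vec_eq_iff scaleC_vec_def scaleR_scaleC)
  show "cinner x y = cnj (cinner y x)"
    unfolding cinner_vec_def cnj_sum by (rule sum.cong[OF refl], rule cinner_commute)
  show "cinner (x + y) z = cinner x z + cinner y z"
    by (simp add: cinner_vec_def cinner_add_left sum.distrib)
  show "cinner (c *\<^sub>C x) y = c * cinner x y"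
    by (simp add: cinner_vec_def scaleC_vec_def cinner_scaleC_left sum_distrib_left)
  show "Re (cinner x y) = inner x y"
    by (simp add: cinner_vec_def inner_vec_def Re_cinner)
qed

end

subsection \<open>Operators\<close>

locale bounded_clinear = bounded_linear f
  for f :: "'a::complex_hilbert_space \<Rightarrow> 'b::complex_hilbert_space" +
  assumes scaleC: "f (c *\<^sub>C x) = c *\<^sub>C f x"

definition cadjoint :: "('a::complex_hilbert_space \<Rightarrow> 'a) \<Rightarrow> 'a \<Rightarrow> 'a" where
  "cadjoint T = (THE S. bounded_clinear S \<and> (\<forall>x y. cinner (T x) y = cinner x (S y)))"

definition positive_op :: "('a::complex_hilbert_space \<Rightarrow> 'a) \<Rightarrow> bool" where
  "positive_op A \<longleftrightarrow> bounded_clinear A \<and> (\<forall>x. cinner (A x) x \<in> \<real>\<^sub>\<ge>\<^sub>0)"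

subsection \<open>The semi-inner product induced by a positive operator\<close>

definition semi_inner :: "('a::complex_hilbert_space \<Rightarrow> 'a) \<Rightarrow> 'a \<Rightarrow> 'a \<Rightarrow> complex" where
  "semi_inner A x y = cinner (A x) y"

text \<open>For positive \<open>A\<close> the number \<open>semi_inner A x x\<close> is real.\<close>

definition semi_norm :: "('a::complex_hilbert_space \<Rightarrow> 'a) \<Rightarrow> 'a \<Rightarrow> real" where
  "semi_norm A x = sqrt (Re (semi_inner A x x))"

text \<open>
  The two suprema are taken in \<open>real\<close>. They are meaningful for \<open>A\<close>-bounded \<open>T\<close> and positive
  \<open>A \<noteq> 0\<close>, when the sets are nonempty and bounded above; in particular for all \<open>T\<close> in
  \<open>ops_with_sharp A\<close> below, and for operator matrices with such entries.
\<close>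

definition op_seminorm ::
    "('a::complex_hilbert_space \<Rightarrow> 'a) \<Rightarrow> ('a \<Rightarrow> 'a) \<Rightarrow> real" where
  "op_seminorm A T = (SUP x\<in>{x. semi_norm A x = 1}. semi_norm A (T x))"

definition num_radius ::
    "('a::complex_hilbert_space \<Rightarrow> 'a) \<Rightarrow> ('a \<Rightarrow> 'a) \<Rightarrow> real" where
  "num_radius A T = (SUP x\<in>{x. semi_norm A x = 1}. cmod (semi_inner A (T x) x))"

definition ops_with_sharp ::
    "('a::complex_hilbert_space \<Rightarrow> 'a) \<Rightarrow> ('a \<Rightarrow> 'a) set" where
  "ops_with_sharp A =
    {T. bounded_clinear T \<and> (\<exists>X. bounded_clinear X \<and> A \<circ> X = cadjoint T \<circ> A)}"

definition sharp ::
    "('a::complex_hilbert_space \<Rightarrow> 'a) \<Rightarrow> ('a \<Rightarrow> 'a) \<Rightarrow> 'a \<Rightarrow> 'a" where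
  "sharp A T = (THE X. bounded_clinear X \<and> A \<circ> X = cadjoint T \<circ> A
                     \<and> range X \<subseteq> closure (range A))"

subsection \<open>Operator matrices\<close>

definition op_matrix ::
    "('d \<Rightarrow> 'd \<Rightarrow> 'a \<Rightarrow> 'a) \<Rightarrow> 'a::complex_hilbert_space ^ 'd::finite \<Rightarrow> 'a ^ 'd" where
  "op_matrix T x = (\<chi> i. \<Sum>j\<in>UNIV. T i j (x $ j))"

definition op_diag ::
    "('a \<Rightarrow> 'a) \<Rightarrow> 'a::complex_hilbert_space ^ 'd::finite \<Rightarrow> 'a ^ 'd" where
  "op_diag A = op_matrix (\<lambda>i j. if i = j then A else (\<lambda>x. 0))"

end

theory Submission
  imports Defs
begin

text \<open>
  Let \<open>x\<close> be a unit vector of the direct sum, so that the squares of \<open>s\<^sub>i = semi_norm A (x $ i)\<close>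
  add up to 1. The value of the quadratic form of the operator matrix at \<open>x\<close> is the sum of the
  diagonal terms \<open>semi_inner A (T i i (x $ i)) (x $ i)\<close> and, for each row \<open>i\<close>, of its off-diagonal
  part. A diagonal term is at most \<open>num_radius A (T i i)\<close> times the square of \<open>s\<^sub>i\<close>, so all of them
  together are bounded by the largest numerical radius. In row \<open>i\<close> each entry is moved to the
  other side of the form by its reduced adjoint, and the Cauchy--Schwarz inequality, for the form
  and then for finite sums, bounds the row by the product of
  \<^item> the root of the sum of the squares of the \<open>s\<^sub>j\<close> with \<open>j \<noteq> i\<close>, which is \<open>sqrt (1 - s\<^sub>i\<^sup>2)\<close>, and
  \<^item> the root of the sum over \<open>j \<noteq> i\<close> of the squared seminorms of \<open>sharp A (T i j) (x $ i)\<close>. This sum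
    is the quadratic form at \<open>x $ i\<close> of the sum of the \<open>T i j \<circ> sharp A (T i j)\<close>; its root is
    therefore at most \<open>s\<^sub>i\<close> times the root of the seminorm of that operator
    (\<open>sum_semi_norm_sharp_le\<close>).

  Since \<open>s\<^sub>i * sqrt (1 - s\<^sub>i\<^sup>2) \<le> 1 / 2\<close>, summation over the rows gives the claim
  (\<open>off_diagonal_row_le\<close>).

  Two kinds of facts support this computation. The adjoint and the reduced adjoint are given by
  definite descriptions, so their existence and uniqueness have to be shown; both rest on the Riesz
  representation theorem on closed subspaces (\<open>riesz_closed_subspace\<close>). The numerical radius and
  the operator seminorm are real suprema, which bound the values only if these values are bounded;
  this is the \<open>A\<close>-boundedness of operators that have a reduced adjoint. It follows from the case
  of \<open>A\<close>-symmetric operators (\<open>semi_norm_symmetric_le\<close>).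
\<close>

section \<open>Riesz representation and adjoints\<close>

text \<open>
  The representing vector minimises \<open>J y = (norm y)\<^sup>2 - 2 * f y\<close> over \<open>S\<close>: by the parallelogram law a
  minimising sequence is Cauchy, and the first variation of \<open>J\<close> at the limit \<open>p\<close> is
  \<open>2 * (inner p s - f s)\<close>. Taking \<open>S = UNIV\<close> gives the Riesz representation theorem, and
  \<open>f = inner x\<close> gives the orthogonal projection of \<open>x\<close> onto \<open>S\<close>.
\<close>

lemma riesz_closed_subspace:
  fixes f :: "'a::{real_inner, complete_space} \<Rightarrow> real"
  assumes f: "bounded_linear f" and S: "subspace S" "closed S"
  shows "\<exists>p\<in>S. \<forall>s\<in>S. inner p s = f s"
proof -
  interpret f: bounded_linear f by (fact f)
  define J where "J y = (norm y)\<^sup>2 - 2 * f y" for y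
  obtain K where K: "\<And>y. norm (f y) \<le> norm y * K"
    using f.bounded by blast
  have J_lower: "- K\<^sup>2 \<le> J y" for y
  proof -
    have "f y \<le> norm y * K"
      using K[of y] by simp
    moreover have "0 \<le> (norm y - K)\<^sup>2" by simp
    ultimately show ?thesis
      unfolding J_def power2_diff by (simp add: mult.commute)
  qed
  have bdd: "bdd_below (J ` S)"
    using J_lower by (intro bdd_belowI2)
  have ne: "S \<noteq> {}"
    using subspace_0[OF S(1)] by blast
  define m where "m = (INF y\<in>S. J y)"
  have m_le: "m \<le> J y" if "y \<in> S" for y
    unfolding m_def using bdd that by (rule cINF_lower)
  have parallelogram: "J u + J v - 2 * J ((1/2) *\<^sub>R (u + v)) = (norm (u - v))\<^sup>2 / 2" for u v
    unfolding J_def power2_norm_eq_inner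
    by (simp add: f.scaleR f.add inner_add_left inner_add_right inner_diff_left inner_diff_right
        inner_commute algebra_simps)
  have close: "(norm (u - v))\<^sup>2 \<le> 2 * J u + 2 * J v - 4 * m" if "u \<in> S" "v \<in> S" for u v
  proof -
    define c where "c = (1/2) *\<^sub>R (u + v)"
    have "c \<in> S"
      unfolding c_def using S(1) that by (intro subspace_scale subspace_add)
    from m_le[OF this] parallelogram[of u v, folded c_def] show ?thesis by simp
  qed
  have "\<exists>y\<in>S. J y < m + inverse (real (Suc n))" for n
    using cINF_less_iff[OF ne bdd, of "m + inverse (real (Suc n))"] by (simp add: m_def)
  then obtain X where X: "\<And>n. X n \<in> S" "\<And>n. J (X n) < m + inverse (real (Suc n))"
    by metis
  have "Cauchy X"
  proof (rule CauchyI)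
    fix e :: real assume "0 < e"
    then obtain N where N: "inverse (real (Suc N)) < e\<^sup>2 / 4"
      using reals_Archimedean[of "e\<^sup>2 / 4"] by auto
    have "norm (X i - X j) < e" if "N \<le> i" "N \<le> j" for i j
    proof -
      have "inverse (real (Suc i)) \<le> inverse (real (Suc N))"
        "inverse (real (Suc j)) \<le> inverse (real (Suc N))"
        using that by (auto intro!: le_imp_inverse_le)
      then have "(norm (X i - X j))\<^sup>2 < e\<^sup>2"
        using close[OF X(1) X(1), of i j] X(2)[of i] X(2)[of j] N by linarith
      then show ?thesis
        using \<open>0 < e\<close> by (simp add: power2_less_imp_less)
    qed
    then show "\<exists>M. \<forall>i\<ge>M. \<forall>j\<ge>M. norm (X i - X j) < e" by blast
  qed
  then obtain p where p: "X \<longlonglongrightarrow> p"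
    using Cauchy_convergent convergent_def by blast
  have pS: "p \<in> S"
    using closed_sequentially[OF S(2) _ p] X(1) by blast
  have "(\<lambda>n. J (X n)) \<longlonglongrightarrow> J p"
    unfolding J_def by (intro tendsto_intros p f.tendsto)
  moreover have "(\<lambda>n. m + inverse (real (Suc n))) \<longlonglongrightarrow> m + 0"
    by (intro tendsto_intros LIMSEQ_inverse_real_of_nat)
  ultimately have Jp: "J p \<le> m"
    using X(2) LIMSEQ_le less_imp_le by (metis (no_types, lifting) add.right_neutral)
  have "inner p s = f s" if s: "s \<in> S" for s
  proof (cases "s = 0")
    case True
    then show ?thesis by (simp add: f.zero)
  next
    case False
    define r where "r = inner p s - f s"
    \<comment> \<open>the minimiser of the quadratic polynomial \<open>J (p + t *\<^sub>R s)\<close> in \<open>t\<close>\<close>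
    define t where "t = - r / (norm s)\<^sup>2"
    have "p + t *\<^sub>R s \<in> S"
      using S(1) pS s by (intro subspace_add subspace_scale)
    then have "J p \<le> J (p + t *\<^sub>R s)"
      using Jp m_le by fastforce
    also have "\<dots> = J p + 2 * t * r + t\<^sup>2 * (norm s)\<^sup>2"
      unfolding J_def r_def power2_norm_eq_inner
      by (simp add: f.add f.scaleR inner_add_left inner_add_right inner_commute
          power2_eq_square algebra_simps)
    also have "\<dots> = J p - r\<^sup>2 / (norm s)\<^sup>2"
      using False unfolding t_def by (simp add: field_simps power2_eq_square)
    finally have "r\<^sup>2 / (norm s)\<^sup>2 \<le> 0" by simp
    then have "r = 0"
      using False by (simp add: divide_le_0_iff)
    then show ?thesis by (simp add: r_def)
  qed
  with pS show ?thesis by blast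
qed

lemma inner_eqI:
  fixes u v :: "'a::real_inner"
  assumes "\<And>x. inner x u = inner x v"
  shows "u = v"
proof -
  have "inner (u - v) (u - v) = 0"
    using assms[of "u - v"] by (simp add: inner_diff_right)
  then show ?thesis by simp
qed

text \<open>
  Through this identity and \<open>Re_cinner\<close> the complex inner product is a function of the real one,
  so equations between values of \<open>cinner\<close> need only be checked for \<open>inner\<close>.
\<close>

lemma Im_cinner: "Im (cinner x y) = inner ((- \<i>) *\<^sub>C x) y"
  by (simp add: Re_cinner[symmetric] cinner_scaleC_left)

lemma cinner_add_right: "cinner x (y + z) = cinner x y + cinner x z"
  by (metis cinner_commute cinner_add_left complex_cnj_add)

lemma cinner_scaleC_right: "cinner x (c *\<^sub>C y) = cnj c * cinner x y"
  by (metis cinner_commute cinner_scaleC_left complex_cnj_mult)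

lemma inner_scaleC_left: "inner (c *\<^sub>C x) y = inner x (cnj c *\<^sub>C y)"
  by (simp add: Re_cinner[symmetric] cinner_scaleC_left cinner_scaleC_right)

lemma norm_scaleC: "norm (c *\<^sub>C x) = cmod c * norm x"
proof -
  have "complex_of_real ((norm (c *\<^sub>C x))\<^sup>2) = c * cnj c * complex_of_real ((norm x)\<^sup>2)"
    by (simp only: cinner_self[symmetric] cinner_scaleC_left cinner_scaleC_right mult_ac)
  also have "\<dots> = complex_of_real ((cmod c * norm x)\<^sup>2)"
    by (simp only: complex_norm_square[symmetric] power_mult_distrib of_real_mult)
  finally have "(norm (c *\<^sub>C x))\<^sup>2 = (cmod c * norm x)\<^sup>2"
    using of_real_eq_iff by blast
  then show ?thesis
    by (simp add: power2_eq_iff_nonneg)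
qed

lemma bounded_linear_scaleC: "bounded_linear ((*\<^sub>C) c)"
proof (rule bounded_linear_intro[where K = "cmod c"])
  show "c *\<^sub>C (r *\<^sub>R x) = r *\<^sub>R c *\<^sub>C x" for r and x :: 'a
    by (simp only: scaleR_scaleC scaleC_scaleC mult.commute)
  show "norm (c *\<^sub>C x) \<le> norm x * cmod c" for x :: 'a
    by (simp add: norm_scaleC mult.commute)
qed (rule scaleC_add_right)

text \<open>
  The adjoint with respect to the real inner product already is the complex adjoint, since \<open>T\<close>
  commutes with multiplication by \<open>- \<i>\<close>.
\<close>

lemma cadjoint_exists:
  assumes T: "bounded_clinear T"
  shows "\<exists>S. bounded_clinear S \<and> (\<forall>x y. cinner (T x) y = cinner x (S y))"
proof -
  interpret T: bounded_clinear T by (fact T)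
  have "\<exists>p. \<forall>s. inner p s = inner (T s) y" for y
    using riesz_closed_subspace[of "\<lambda>s. inner (T s) y" UNIV]
      bounded_linear_inner_left_comp[OF T.bounded_linear_axioms] by auto
  then obtain S where S: "\<And>y s. inner (S y) s = inner (T s) y" by metis
  have S': "inner (T x) y = inner x (S y)" for x y
    by (metis S inner_commute)
  have cS: "cinner (T x) y = cinner x (S y)" for x y
    by (rule complex_eqI) (simp_all only: Re_cinner Im_cinner S'[symmetric] T.scaleC)
  obtain K where K: "\<And>x. norm (T x) \<le> norm x * K" "0 \<le> K"
    using T.nonneg_bounded by blast
  have "bounded_linear S"
  proof (rule bounded_linear_intro)
    show "S (x + y) = S x + S y" for x y
      by (rule inner_eqI) (simp add: S'[symmetric] inner_add_right)
    show "S (r *\<^sub>R x) = r *\<^sub>R S x" for r x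
      by (rule inner_eqI) (simp add: S'[symmetric])
    show "norm (S y) \<le> norm y * K" for y
    proof (cases "S y = 0")
      case False
      have "norm (S y) * norm (S y) = inner (T (S y)) y"
        by (simp add: S' power2_norm_eq_inner[symmetric] power2_eq_square)
      also have "\<dots> \<le> norm (T (S y)) * norm y"
        by (rule norm_cauchy_schwarz)
      also have "\<dots> \<le> norm (S y) * K * norm y"
        by (intro mult_right_mono K) simp
      finally show ?thesis
        using False by (simp add: mult.assoc mult.commute)
    qed (use K in simp)
  qed
  moreover have "S (c *\<^sub>C y) = c *\<^sub>C S y" for c y
    by (rule inner_eqI) (metis S' T.scaleC complex_cnj_cnj inner_scaleC_left)
  ultimately show ?thesis
    using cS by (auto intro!: exI[of _ S] bounded_clinear.intro bounded_clinear_axioms.intro)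
qed

lemma cinner_cadjoint:
  assumes "bounded_clinear T"
  shows "cinner (T x) y = cinner x (cadjoint T y)"
proof -
  have "\<exists>!S. bounded_clinear S \<and> (\<forall>x y. cinner (T x) y = cinner x (S y))"
  proof (rule ex_ex1I[OF cadjoint_exists[OF assms]])
    fix S S'
    assume "bounded_clinear S \<and> (\<forall>x y. cinner (T x) y = cinner x (S y))"
      and "bounded_clinear S' \<and> (\<forall>x y. cinner (T x) y = cinner x (S' y))"
    then have "inner x (S y) = inner x (S' y)" for x y
      by (metis Re_cinner)
    then have "S y = S' y" for y
      by (rule inner_eqI)
    then show "S = S'" ..
  qed
  from theI'[OF this, folded cadjoint_def]
  show "cinner (T x) y = cinner x (cadjoint T y)"
    by blast
qed

lemma subspace_closure:
  fixes S :: "'a::real_normed_vector set"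
  assumes S: "subspace S"
  shows "subspace (closure S)"
  unfolding subspace_def
proof (intro conjI ballI allI)
  show "0 \<in> closure S"
    using subspace_0[OF S] closure_subset by blast
next
  fix x y assume "x \<in> closure S" "y \<in> closure S"
  then obtain f g where "\<And>n. f n \<in> S" "f \<longlonglongrightarrow> x" "\<And>n. g n \<in> S" "g \<longlonglongrightarrow> y"
    unfolding closure_sequential by blast
  then have "(\<lambda>n. f n + g n) \<longlonglongrightarrow> x + y" "\<And>n. f n + g n \<in> S"
    by (auto intro: tendsto_add subspace_add[OF S])
  then show "x + y \<in> closure S"
    unfolding closure_sequential by (intro exI[of _ "\<lambda>n. f n + g n"]) blast
next
  fix c x assume "x \<in> closure S"
  then show "c *\<^sub>R x \<in> closure S"
    using closure_bounded_linear_image_subset[OF bounded_linear_scaleR_right, of c S]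
      closure_mono[of "(*\<^sub>R) c ` S" S] subspace_scale[OF S] by blast
qed

lemma projection_exists:
  fixes M :: "'a::complex_hilbert_space set"
  assumes M: "subspace M" "closed M" and scaleC_M: "\<And>c x. x \<in> M \<Longrightarrow> c *\<^sub>C x \<in> M"
  shows "\<exists>P. bounded_clinear P \<and> range P \<subseteq> M \<and> (\<forall>x. \<forall>s\<in>M. inner (P x) s = inner x s)"
proof -
  have "\<exists>p. p \<in> M \<and> (\<forall>s\<in>M. inner p s = inner x s)" for x
    using riesz_closed_subspace[OF bounded_linear_inner_right M] by blast
  then obtain P where P: "\<And>x. P x \<in> M" "\<And>x s. s \<in> M \<Longrightarrow> inner (P x) s = inner x s"
    by metis
  have eq: "u = v" if "u \<in> M" "v \<in> M" "\<And>s. s \<in> M \<Longrightarrow> inner u s = inner v s" for u v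
  proof -
    have "inner (u - v) (u - v) = 0"
      using that(3)[OF subspace_diff[OF M(1) that(1,2)]] by (simp add: inner_diff_left)
    then show ?thesis by simp
  qed
  have "bounded_linear P"
  proof (rule bounded_linear_intro[where K = 1])
    show "P (x + y) = P x + P y" for x y
      by (rule eq) (simp_all add: P subspace_add M inner_add_left)
    show "P (r *\<^sub>R x) = r *\<^sub>R P x" for r x
      by (rule eq) (simp_all add: P subspace_scale M)
    show "norm (P x) \<le> norm x * 1" for x
    proof (cases "P x = 0")
      case False
      have "norm (P x) * norm (P x) = inner x (P x)"
        using P(2)[OF P(1)] by (metis power2_norm_eq_inner power2_eq_square)
      also have "\<dots> \<le> norm x * norm (P x)"
        by (rule norm_cauchy_schwarz)
      finally show ?thesis using False by simp
    qed simp
  qed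
  moreover have "P (c *\<^sub>C x) = c *\<^sub>C P x" for c x
    by (rule eq) (simp_all add: P scaleC_M inner_scaleC_left)
  ultimately show ?thesis
    using P by (auto intro!: exI[of _ P] bounded_clinear.intro bounded_clinear_axioms.intro)
qed

section \<open>The semi-inner product of a positive operator\<close>

locale positive_operator =
  fixes A :: "'a::complex_hilbert_space \<Rightarrow> 'a"
  assumes positive: "positive_op A"
begin

sublocale A: bounded_clinear A
  using positive by (simp add: positive_op_def)

lemma semi_inner_add_left: "semi_inner A (x + y) z = semi_inner A x z + semi_inner A y z"
  and semi_inner_add_right: "semi_inner A x (y + z) = semi_inner A x y + semi_inner A x z"
  and semi_inner_scaleC_left: "semi_inner A (c *\<^sub>C x) y = c * semi_inner A x y"
  and semi_inner_scaleC_right: "semi_inner A x (c *\<^sub>C y) = cnj c * semi_inner A x y"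
  by (simp_all add: semi_inner_def A.add A.scaleC cinner_add_left cinner_add_right
      cinner_scaleC_left cinner_scaleC_right)

lemma semi_inner_zero_left: "semi_inner A 0 y = 0"
  using semi_inner_add_left[of 0 0 y] by simp

lemma semi_inner_sum_left: "semi_inner A (\<Sum>i\<in>I. f i) y = (\<Sum>i\<in>I. semi_inner A (f i) y)"
  by (induction I rule: infinite_finite_induct)
    (simp_all add: semi_inner_add_left semi_inner_zero_left)

lemma semi_inner_self: "semi_inner A x x = complex_of_real ((semi_norm A x)\<^sup>2)"
  using positive
  by (auto simp: complex_nonneg_Reals_iff positive_op_def semi_norm_def semi_inner_def
      complex_eq_iff)

lemma semi_norm_nonneg: "0 \<le> semi_norm A x"
  using positive
  by (auto simp: complex_nonneg_Reals_iff positive_op_def semi_norm_def semi_inner_def)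

text \<open>
  Polarisation: the form is real on the diagonal, so its values at \<open>u + v\<close> relate \<open>(u, v)\<close> to
  \<open>(v, u)\<close>. The pair \<open>(x, y)\<close> gives the imaginary parts, \<open>(\<i> *\<^sub>C x, y)\<close> the real parts.
\<close>

lemma semi_inner_commute: "semi_inner A y x = cnj (semi_inner A x y)"
proof -
  have Im: "Im (semi_inner A u v) + Im (semi_inner A v u) = 0" for u v
    using arg_cong[OF semi_inner_self[of "u + v",
      unfolded semi_inner_add_left semi_inner_add_right], of Im]
    by (simp add: semi_inner_self)
  show ?thesis
    using Im[of x y] Im[of "\<i> *\<^sub>C x" y]
    by (simp add: complex_eq_iff semi_inner_scaleC_left semi_inner_scaleC_right)
qed

lemma selfadjoint: "cinner (A x) y = cinner x (A y)"
  using semi_inner_commute[of x y] cinner_commute[of x "A y"] by (simp add: semi_inner_def)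

lemma semi_norm_scaleC: "semi_norm A (c *\<^sub>C x) = cmod c * semi_norm A x"
proof -
  have "complex_of_real ((semi_norm A (c *\<^sub>C x))\<^sup>2)
      = c * cnj c * complex_of_real ((semi_norm A x)\<^sup>2)"
    by (simp only: semi_inner_self[symmetric] semi_inner_scaleC_left semi_inner_scaleC_right
        mult_ac)
  also have "\<dots> = complex_of_real ((cmod c)\<^sup>2 * (semi_norm A x)\<^sup>2)"
    by (simp only: complex_norm_square[symmetric] of_real_mult)
  finally have "(semi_norm A (c *\<^sub>C x))\<^sup>2 = (cmod c * semi_norm A x)\<^sup>2"
    unfolding of_real_eq_iff power_mult_distrib .
  then show ?thesis
    by (simp add: power2_eq_iff_nonneg semi_norm_nonneg)
qed

lemma semi_norm_scaleR: "semi_norm A (r *\<^sub>R x) = \<bar>r\<bar> * semi_norm A x"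
  by (simp add: scaleR_scaleC semi_norm_scaleC)

lemma Re_semi_inner_le: "Re (semi_inner A x y) \<le> semi_norm A x * semi_norm A y"
proof -
  define r a b where "r = Re (semi_inner A x y)" and "a = (semi_norm A x)\<^sup>2"
    and "b = (semi_norm A y)\<^sup>2"
  have quad: "0 \<le> t\<^sup>2 * a + 2 * t * r + b" for t
  proof -
    define z where "z = complex_of_real t *\<^sub>C x + y"
    have "(semi_norm A z)\<^sup>2 = Re (semi_inner A z z)"
      by (simp add: semi_inner_self)
    also have "\<dots> = t\<^sup>2 * a + 2 * t * r + b"
      unfolding z_def semi_inner_add_left semi_inner_add_right semi_inner_scaleC_left
        semi_inner_scaleC_right semi_inner_commute[of y x]
      by (simp add: semi_inner_self r_def a_def b_def power2_eq_square algebra_simps)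
    finally show ?thesis by (metis zero_le_power2)
  qed
  \<comment> \<open>the discriminant of a nonnegative quadratic polynomial is not positive\<close>
  have "r\<^sup>2 \<le> a * b"
  proof (cases "a = 0")
    case True
    then have "r = 0"
      using quad[of "- (b + 1) / (2 * r)"] by (cases "r = 0") (simp_all add: field_simps)
    then show ?thesis by (simp add: True)
  next
    case False
    then have "0 < a" by (simp add: a_def)
    then show ?thesis
      using quad[of "- r / a"] by (simp add: field_simps power2_eq_square)
  qed
  then have "r\<^sup>2 \<le> (semi_norm A x * semi_norm A y)\<^sup>2"
    by (simp add: a_def b_def power_mult_distrib)
  then show ?thesis
    unfolding r_def by (rule power2_le_imp_le) (simp add: semi_norm_nonneg)
qed

lemma semi_inner_cauchy_schwarz: "cmod (semi_inner A x y) \<le> semi_norm A x * semi_norm A y"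
proof (cases "semi_inner A x y = 0")
  case True
  then show ?thesis by (simp add: semi_norm_nonneg)
next
  case False
  define z where "z = semi_inner A x y"
  \<comment> \<open>a phase that turns the value of the form into its modulus\<close>
  define c where "c = cnj z / complex_of_real (cmod z)"
  have "cmod c = 1" "c * z = complex_of_real (cmod z)"
    using False complex_norm_square[of z]
    by (auto simp: c_def z_def norm_divide field_simps power2_eq_square)
  then show ?thesis
    using Re_semi_inner_le[of "c *\<^sub>C x" y]
    by (simp add: semi_inner_scaleC_left semi_norm_scaleC z_def)
qed

lemma semi_norm_le_norm: "\<exists>C. \<forall>x. semi_norm A x \<le> C * norm x"
proof -
  obtain K where K: "\<And>x. norm (A x) \<le> norm x * K" "0 \<le> K"
    using A.nonneg_bounded by blast
  have "semi_norm A x \<le> sqrt K * norm x" for x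
  proof (rule power2_le_imp_le)
    have "(semi_norm A x)\<^sup>2 = inner (A x) x"
      using arg_cong[OF semi_inner_self[of x], of Re] by (simp add: semi_inner_def Re_cinner)
    also have "\<dots> \<le> norm (A x) * norm x"
      by (rule norm_cauchy_schwarz)
    also have "\<dots> \<le> norm x * K * norm x"
      by (intro mult_right_mono K) simp
    finally show "(semi_norm A x)\<^sup>2 \<le> (sqrt K * norm x)\<^sup>2"
      using K(2) by (simp add: power_mult_distrib power2_eq_square[of "norm x"] mult_ac)
  qed (use K in simp)
  then show ?thesis by blast
qed

lemma exists_semi_norm_1:
  assumes "A \<noteq> (\<lambda>x. 0)"
  shows "\<exists>x. semi_norm A x = 1"
proof -
  obtain x where x: "A x \<noteq> 0"
    using assms by auto
  have "semi_norm A x \<noteq> 0"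
  proof
    assume "semi_norm A x = 0"
    then have "cinner (A x) (A x) = 0"
      using semi_inner_cauchy_schwarz[of x "A x"] by (simp add: semi_inner_def)
    with x show False by (simp add: cinner_self)
  qed
  then have "semi_norm A ((1 / semi_norm A x) *\<^sub>R x) = 1"
    by (simp add: semi_norm_scaleR semi_norm_nonneg)
  then show ?thesis by blast
qed

section \<open>The reduced A-adjoint\<close>

text \<open>
  A solution \<open>X\<close> of \<open>A \<circ> X = cadjoint T \<circ> A\<close> is made to take values in the closure of the range of
  \<open>A\<close> by composing it with the orthogonal projection \<open>P\<close> onto that closure. It remains a solution
  because \<open>A\<close> is self-adjoint: its kernel is the orthogonal complement of its range, hence
  \<open>A \<circ> P = A\<close>. For the same reason the difference of two such solutions takes values in a subspace
  and in its orthogonal complement, so it vanishes.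
\<close>

lemma
  assumes "T \<in> ops_with_sharp A"
  shows bounded_clinear_sharp: "bounded_clinear (sharp A T)"
    and comp_sharp: "A \<circ> sharp A T = cadjoint T \<circ> A"
proof -
  define M where "M = closure (range A)"
  have sub: "subspace (range A)"
    using A.linear_axioms linear_subspace_image subspace_UNIV by blast
  then have "subspace M"
    unfolding M_def by (rule subspace_closure)
  moreover have "c *\<^sub>C x \<in> M" if "x \<in> M" for c x
  proof -
    have "(*\<^sub>C) c ` range A \<subseteq> range A"
      by (auto simp: A.scaleC[symmetric])
    then show ?thesis
      using that closure_bounded_linear_image_subset[OF bounded_linear_scaleC, of c "range A"]
        closure_mono[of "(*\<^sub>C) c ` range A" "range A"] unfolding M_def by blast
  qed
  ultimately obtain P where P: "bounded_clinear P" "range P \<subseteq> M"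
      "\<And>x s. s \<in> M \<Longrightarrow> inner (P x) s = inner x s"
    using projection_exists[of M] by (auto simp: M_def)
  interpret P: bounded_clinear P by (fact P(1))
  obtain X where X: "bounded_clinear X" "A \<circ> X = cadjoint T \<circ> A"
    using assms by (auto simp: ops_with_sharp_def)
  interpret X: bounded_clinear X by (fact X(1))
  have A_P: "A (P x) = A x" for x
  proof -
    have adj: "inner y (A v) = inner v (A y)" for y v
      using selfadjoint[of y v] by (metis Re_cinner inner_commute)
    have "A y \<in> M" for y
      using closure_subset[of "range A"] by (auto simp: M_def)
    then have "inner y (A (P x)) = inner y (A x)" for y
      unfolding adj[of y] by (rule P(3))
    then show ?thesis
      by (rule inner_eqI)
  qed
  have "\<exists>!X. bounded_clinear X \<and> A \<circ> X = cadjoint T \<circ> A \<and> range X \<subseteq> M"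
  proof (rule ex1I)
    have "bounded_clinear (P \<circ> X)"
      using bounded_linear_compose[OF P.bounded_linear_axioms X.bounded_linear_axioms]
      by (auto intro!: bounded_clinear.intro bounded_clinear_axioms.intro
          simp: comp_def P.scaleC X.scaleC)
    moreover have "A \<circ> (P \<circ> X) = cadjoint T \<circ> A"
      using X(2) by (simp add: fun_eq_iff A_P)
    ultimately show "bounded_clinear (P \<circ> X) \<and> A \<circ> (P \<circ> X) = cadjoint T \<circ> A
        \<and> range (P \<circ> X) \<subseteq> M"
      using P(2) by auto
  next
    fix Y assume Y: "bounded_clinear Y \<and> A \<circ> Y = cadjoint T \<circ> A \<and> range Y \<subseteq> M"
    have "Y v = P (X v)" for v
    proof -
      define z where "z = Y v - P (X v)"
      have "z \<in> M"
        using Y P(2) \<open>subspace M\<close> by (auto simp: z_def intro!: subspace_diff)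
      have "A (Y v) = A (X v)"
        using Y X(2) by (metis comp_apply)
      then have "A z = 0"
        by (simp add: z_def A.diff A_P)
      then have "inner z (A w) = 0" for w
        using selfadjoint[of z w] by (metis Re_cinner inner_zero_left)
      then have "M \<subseteq> {y. inner z y = 0}"
        unfolding M_def by (intro closure_minimal closed_hyperplane) auto
      with \<open>z \<in> M\<close> show ?thesis
        by (auto simp: z_def)
    qed
    then show "Y = P \<circ> X" by auto
  qed
  from theI'[OF this, unfolded M_def, folded sharp_def]
  show "bounded_clinear (sharp A T)" "A \<circ> sharp A T = cadjoint T \<circ> A"
    by blast+
qed

lemma semi_inner_sharp:
  assumes "T \<in> ops_with_sharp A"
  shows "semi_inner A (T x) y = semi_inner A x (sharp A T y)"
proof -
  have "bounded_clinear T"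
    using assms by (simp add: ops_with_sharp_def)
  from cinner_cadjoint[OF this, of x "A y"]
  have "cinner (T x) (A y) = cinner x (A (sharp A T y))"
    using fun_cong[OF comp_sharp[OF assms], of y] by simp
  then show ?thesis
    unfolding semi_inner_def selfadjoint[of "T x"] selfadjoint[of x] .
qed

lemma semi_inner_sharp_left:
  assumes "T \<in> ops_with_sharp A"
  shows "semi_inner A (sharp A T x) y = semi_inner A x (T y)"
  unfolding semi_inner_commute[of "sharp A T x" y] semi_inner_commute[of x "T y"]
    semi_inner_sharp[OF assms] ..

section \<open>A-boundedness\<close>

text \<open>
  The seminorms \<open>a n\<close> of the iterates \<open>(S ^^ n) x\<close> form a log-convex sequence, by symmetry and the
  Cauchy--Schwarz inequality. If \<open>a 0 = 0\<close> then also \<open>a 1 = 0\<close>. Otherwise \<open>a n\<close> grows at least like the powers of \<open>a 1 / a 0\<close>; it grows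
  at most like the powers of \<open>K\<close>, because \<open>A\<close> and \<open>S\<close> are bounded. So \<open>a 1 / a 0 \<le> K\<close>.
\<close>

lemma semi_norm_symmetric_le:
  assumes K: "0 < K" "\<And>y. norm (S y) \<le> K * norm y"
    and S: "\<And>x y. semi_inner A (S x) y = semi_inner A x (S y)"
  shows "semi_norm A (S x) \<le> K * semi_norm A x"
proof -
  define a where "a n = semi_norm A ((S ^^ n) x)" for n
  have a_nonneg: "0 \<le> a n" for n
    by (simp add: a_def semi_norm_nonneg)
  have log_convex: "(a (Suc n))\<^sup>2 \<le> a n * a (Suc (Suc n))" for n
  proof -
    have "complex_of_real ((a (Suc n))\<^sup>2) = semi_inner A ((S ^^ n) x) ((S ^^ Suc (Suc n)) x)"
      unfolding a_def semi_inner_self[symmetric] by (simp add: S)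
    then have "(a (Suc n))\<^sup>2 = cmod (semi_inner A ((S ^^ n) x) ((S ^^ Suc (Suc n)) x))"
      by (metis norm_of_real abs_of_nonneg zero_le_power2)
    then show ?thesis
      using semi_inner_cauchy_schwarz by (simp add: a_def)
  qed
  have ratio: "a 1 * a n \<le> a 0 * a (Suc n)" for n
  proof (induction n)
    case (Suc n)
    show ?case
    proof (cases "a n = 0")
      case True
      then have "a (Suc n) = 0"
        using log_convex[of n] by simp
      then show ?thesis by (simp add: a_nonneg)
    next
      case False
      have "a n * (a 1 * a (Suc n)) \<le> a (Suc n) * (a 0 * a (Suc n))"
        using mult_left_mono[OF Suc a_nonneg[of "Suc n"]] by (simp add: mult_ac)
      also have "\<dots> \<le> a n * (a 0 * a (Suc (Suc n)))"
        using mult_left_mono[OF log_convex[of n] a_nonneg[of 0]]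
        by (simp add: power2_eq_square mult_ac)
      finally show ?thesis
        using False a_nonneg[of n] by simp
    qed
  qed simp
  show ?thesis
  proof (cases "a 0 = 0")
    case True
    then have "a 1 = 0"
      using log_convex[of 0] by simp
    with True show ?thesis by (simp add: a_def)
  next
    case False
    then have a0: "0 < a 0"
      using a_nonneg[of 0] by simp
    define q where "q = a 1 / a 0"
    have q_nonneg: "0 \<le> q"
      by (simp add: q_def a_nonneg)
    have pow: "q ^ n * a 0 \<le> a n" for n
    proof (induction n)
      case (Suc n)
      have "q ^ Suc n * a 0 \<le> q * a n"
        using mult_left_mono[OF Suc q_nonneg] by (simp add: mult_ac)
      also have "\<dots> \<le> a (Suc n)"
        using ratio[of n] a0 by (simp add: q_def field_simps)
      finally show ?case .
    qed simp
    obtain C where C: "\<And>y. semi_norm A y \<le> C * norm y"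
      using semi_norm_le_norm by blast
    have norm_pow: "norm ((S ^^ n) x) \<le> K ^ n * norm x" for n
    proof (induction n)
      case (Suc n)
      have "norm ((S ^^ Suc n) x) \<le> K * norm ((S ^^ n) x)"
        using K(2) by simp
      also have "\<dots> \<le> K * (K ^ n * norm x)"
        using Suc K(1) by (intro mult_left_mono) simp_all
      finally show ?case
        by (simp add: mult.assoc)
    qed simp
    have "q \<le> K"
    proof (rule ccontr)
      assume "\<not> q \<le> K"
      then have "1 < q / K"
        using K(1) by simp
      then obtain n where n: "\<bar>C\<bar> * norm x / a 0 < (q / K) ^ n"
        using real_arch_pow by blast
      have "q ^ n * a 0 \<le> C * norm ((S ^^ n) x)"
        using pow[of n] C[of "(S ^^ n) x"] by (simp add: a_def)
      also have "\<dots> \<le> \<bar>C\<bar> * norm ((S ^^ n) x)"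
        by (intro mult_right_mono) auto
      also have "\<dots> \<le> \<bar>C\<bar> * (K ^ n * norm x)"
        by (intro mult_left_mono norm_pow) auto
      finally have "(q / K) ^ n \<le> \<bar>C\<bar> * norm x / a 0"
        using a0 K(1) by (simp add: field_simps power_divide)
      with n show False by simp
    qed
    then show ?thesis
      using a0 by (simp add: q_def field_simps a_def)
  qed
qed

lemma semi_norm_bounded_symmetric:
  assumes "bounded_linear S" and "\<And>x y. semi_inner A (S x) y = semi_inner A x (S y)"
  shows "\<exists>K. \<forall>x. semi_norm A (S x) \<le> K * semi_norm A x"
proof -
  obtain K where "0 < K" "\<And>y. norm (S y) \<le> K * norm y"
    using bounded_linear.pos_bounded[OF assms(1)] by (auto simp: mult.commute)
  then show ?thesis
    using semi_norm_symmetric_le assms(2) by blast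
qed

text \<open>
  The operator \<open>sharp A T \<circ> T\<close> is \<open>A\<close>-symmetric, hence \<open>A\<close>-bounded, and its quadratic form at \<open>x\<close> is
  the square of \<open>semi_norm A (T x)\<close>.
\<close>

lemma semi_norm_bounded_sharp:
  assumes T: "T \<in> ops_with_sharp A"
  shows "\<exists>K. \<forall>x. semi_norm A (T x) \<le> K * semi_norm A x"
proof -
  have "bounded_clinear T"
    using assms by (simp add: ops_with_sharp_def)
  then have "bounded_linear (sharp A T \<circ> T)"
    using bounded_clinear_sharp[OF T] bounded_linear_compose
    by (auto simp: bounded_clinear_def comp_def)
  then obtain K where K: "\<And>x. semi_norm A (sharp A T (T x)) \<le> K * semi_norm A x"
    using semi_norm_bounded_symmetric[of "sharp A T \<circ> T"]
    by (auto simp: semi_inner_sharp[OF T] semi_inner_sharp_left[OF T])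
  have "semi_norm A (T x) \<le> sqrt \<bar>K\<bar> * semi_norm A x" for x
  proof (rule power2_le_imp_le)
    have "complex_of_real ((semi_norm A (T x))\<^sup>2) = semi_inner A x (sharp A T (T x))"
      unfolding semi_inner_self[symmetric] by (rule semi_inner_sharp[OF T])
    then have "(semi_norm A (T x))\<^sup>2 = cmod (semi_inner A x (sharp A T (T x)))"
      by (metis norm_of_real abs_of_nonneg zero_le_power2)
    also have "\<dots> \<le> semi_norm A x * semi_norm A (sharp A T (T x))"
      by (rule semi_inner_cauchy_schwarz)
    also have "\<dots> \<le> semi_norm A x * (\<bar>K\<bar> * semi_norm A x)"
      using K[of x] mult_right_mono[OF abs_ge_self[of K] semi_norm_nonneg[of x]]
      by (intro mult_left_mono semi_norm_nonneg) linarith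
    finally show "(semi_norm A (T x))\<^sup>2 \<le> (sqrt \<bar>K\<bar> * semi_norm A x)\<^sup>2"
      by (simp add: power_mult_distrib power2_eq_square[of "semi_norm A x"] mult_ac)
  qed (simp add: semi_norm_nonneg)
  then show ?thesis by blast
qed

text \<open>
  The constant \<open>K\<close> makes the supremum finite, and it handles the vectors of seminorm zero, which
  cannot be normalised.
\<close>

lemma semi_norm_le_op_seminorm:
  assumes "linear T" and K: "\<And>x. semi_norm A (T x) \<le> K * semi_norm A x"
  shows "semi_norm A (T x) \<le> op_seminorm A T * semi_norm A x"
proof (cases "semi_norm A x = 0")
  case True
  then show ?thesis using K[of x] by simp
next
  case False
  define y where "y = (1 / semi_norm A x) *\<^sub>R x"
  have "semi_norm A y = 1"
    using False by (simp add: y_def semi_norm_scaleR semi_norm_nonneg)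
  moreover have "bdd_above ((\<lambda>x. semi_norm A (T x)) ` {x. semi_norm A x = 1})"
    using K by (intro bdd_aboveI2[of _ _ K]) (metis mem_Collect_eq mult.right_neutral)
  ultimately have "semi_norm A (T y) \<le> op_seminorm A T"
    unfolding op_seminorm_def by (intro cSUP_upper) auto
  moreover have "semi_norm A (T y) = semi_norm A (T x) / semi_norm A x"
    by (simp add: y_def linear_scale[OF assms(1)] semi_norm_scaleR semi_norm_nonneg)
  ultimately show ?thesis
    using False semi_norm_nonneg[of x] by (simp add: field_simps)
qed

lemma semi_inner_le_num_radius:
  assumes "linear T" and K: "\<And>x. semi_norm A (T x) \<le> K * semi_norm A x"
  shows "cmod (semi_inner A (T x) x) \<le> num_radius A T * (semi_norm A x)\<^sup>2"
proof (cases "semi_norm A x = 0")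
  case True
  then show ?thesis using semi_inner_cauchy_schwarz[of "T x" x] by simp
next
  case False
  define r where "r = 1 / semi_norm A x"
  define y where "y = r *\<^sub>R x"
  have "semi_norm A y = 1"
    using False by (simp add: y_def r_def semi_norm_scaleR semi_norm_nonneg)
  moreover have "bdd_above ((\<lambda>x. cmod (semi_inner A (T x) x)) ` {x. semi_norm A x = 1})"
  proof (rule bdd_aboveI2)
    fix x assume "x \<in> {x. semi_norm A x = 1}"
    then show "cmod (semi_inner A (T x) x) \<le> K"
      using semi_inner_cauchy_schwarz[of "T x" x] K[of x] by simp
  qed
  ultimately have "cmod (semi_inner A (T y) y) \<le> num_radius A T"
    unfolding num_radius_def by (intro cSUP_upper) auto
  moreover have "T y = r *\<^sub>R T x"
    by (simp add: y_def linear_scale[OF assms(1)])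
  then have "semi_inner A (T y) y = complex_of_real (r\<^sup>2) * semi_inner A (T x) x"
    unfolding y_def scaleR_scaleC semi_inner_scaleC_left semi_inner_scaleC_right
    by (simp add: semi_inner_scaleC_left power2_eq_square)
  then have "cmod (semi_inner A (T y) y) = cmod (semi_inner A (T x) x) / (semi_norm A x)\<^sup>2"
    by (simp add: r_def norm_mult norm_divide norm_power power_divide)
  ultimately show ?thesis
    using False by (simp add: field_simps)
qed

section \<open>Operator matrices\<close>

text \<open>
  The left-hand side is the quadratic form at \<open>x\<close> of the sum of the \<open>T j \<circ> sharp A (T j)\<close>, an
  \<open>A\<close>-symmetric operator.
\<close>

lemma sum_semi_norm_sharp_le:
  assumes T: "\<And>j. j \<in> J \<Longrightarrow> T j \<in> ops_with_sharp A"
  shows "(\<Sum>j\<in>J. (semi_norm A (sharp A (T j) x))\<^sup>2)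
    \<le> op_seminorm A (\<lambda>x. \<Sum>j\<in>J. (T j \<circ> sharp A (T j)) x) * (semi_norm A x)\<^sup>2"
proof -
  define S where "S = (\<lambda>x. \<Sum>j\<in>J. (T j \<circ> sharp A (T j)) x)"
  have "bounded_linear (T j \<circ> sharp A (T j))" if "j \<in> J" for j
    using T[OF that] bounded_clinear_sharp[OF T[OF that]] bounded_linear_compose
    by (auto simp: bounded_clinear_def comp_def ops_with_sharp_def)
  then have lin: "bounded_linear S"
    unfolding S_def by (intro bounded_linear_sum)
  have S: "semi_inner A (S x) y = (\<Sum>j\<in>J. semi_inner A (sharp A (T j) x) (sharp A (T j) y))"
    for x y
    by (simp add: S_def semi_inner_sum_left semi_inner_sharp T)
  have "semi_inner A (S x) y = semi_inner A x (S y)" for x y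
    unfolding semi_inner_commute[of x "S y"] S cnj_sum
    by (intro sum.cong refl semi_inner_commute)
  then obtain K where "\<And>x. semi_norm A (S x) \<le> K * semi_norm A x"
    using semi_norm_bounded_symmetric[OF lin] by blast
  then have "semi_norm A (S x) \<le> op_seminorm A S * semi_norm A x"
    using semi_norm_le_op_seminorm bounded_linear.linear[OF lin] by blast
  from mult_right_mono[OF this semi_norm_nonneg]
  have "semi_norm A (S x) * semi_norm A x \<le> op_seminorm A S * (semi_norm A x)\<^sup>2"
    by (simp add: power2_eq_square mult.assoc)
  moreover have "(\<Sum>j\<in>J. (semi_norm A (sharp A (T j) x))\<^sup>2) = Re (semi_inner A (S x) x)"
    by (simp add: S semi_inner_self)
  ultimately show ?thesis
    using Re_semi_inner_le[of "S x" x] by (simp add: S_def)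
qed

lemma off_diagonal_row_le:
  fixes x :: "'a ^ 'd::finite"
  assumes T: "\<And>j. T j \<in> ops_with_sharp A" and x: "(\<Sum>j\<in>UNIV. (semi_norm A (x $ j))\<^sup>2) = 1"
  shows "cmod (\<Sum>j\<in>UNIV - {i}. semi_inner A (T j (x $ j)) (x $ i))
    \<le> 1 / 2 * sqrt (op_seminorm A (\<lambda>x. \<Sum>j\<in>UNIV - {i}. (T j \<circ> sharp A (T j)) x))"
proof -
  let ?J = "UNIV - {i}"
  define N where "N = op_seminorm A (\<lambda>x. \<Sum>j\<in>?J. (T j \<circ> sharp A (T j)) x)"
  define s where "s = semi_norm A (x $ i)"
  define u where "u = (\<Sum>j\<in>?J. (semi_norm A (x $ j))\<^sup>2)"
  have u: "s\<^sup>2 + u = 1"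
    using x unfolding s_def u_def by (subst (asm) sum.remove[of _ i]) auto
  have u_nonneg: "0 \<le> u"
    unfolding u_def by (intro sum_nonneg) simp
  have s_nonneg: "0 \<le> s"
    by (simp add: s_def semi_norm_nonneg)
  have amgm: "s * sqrt u \<le> 1 / 2"
    using sum_squares_bound[of s "sqrt u"] u u_nonneg by simp
  have "cmod (\<Sum>j\<in>?J. semi_inner A (T j (x $ j)) (x $ i))
      \<le> (\<Sum>j\<in>?J. cmod (semi_inner A (x $ j) (sharp A (T j) (x $ i))))"
    by (simp add: semi_inner_sharp T norm_sum)
  also have "\<dots> \<le> (\<Sum>j\<in>?J. \<bar>semi_norm A (x $ j)\<bar> * \<bar>semi_norm A (sharp A (T j) (x $ i))\<bar>)"
    by (intro sum_mono) (simp add: semi_inner_cauchy_schwarz semi_norm_nonneg)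
  also have "\<dots> \<le> sqrt u * sqrt (\<Sum>j\<in>?J. (semi_norm A (sharp A (T j) (x $ i)))\<^sup>2)"
    using L2_set_mult_ineq[of _ _ ?J] by (simp add: L2_set_def u_def)
  also have "\<dots> \<le> sqrt u * sqrt (N * s\<^sup>2)"
    using sum_semi_norm_sharp_le[of ?J T "x $ i"] T u_nonneg
    by (intro mult_left_mono) (simp_all add: N_def s_def)
  also have "\<dots> = (s * sqrt u) * sqrt N"
    using s_nonneg by (simp add: real_sqrt_mult mult_ac)
  finally have row: "cmod (\<Sum>j\<in>?J. semi_inner A (T j (x $ j)) (x $ i)) \<le> (s * sqrt u) * sqrt N" .
  \<comment> \<open>\<open>sqrt\<close> is negative on negative numbers, so the next estimate needs the sign of \<open>N\<close>. It is
    read off at a component of \<open>x\<close> of nonzero seminorm.\<close>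
  have "0 \<le> N"
  proof -
    obtain k where k: "semi_norm A (x $ k) \<noteq> 0"
      using x by force
    have "0 \<le> (\<Sum>j\<in>?J. (semi_norm A (sharp A (T j) (x $ k)))\<^sup>2)"
      by (intro sum_nonneg) simp
    also have "\<dots> \<le> N * (semi_norm A (x $ k))\<^sup>2"
      unfolding N_def by (rule sum_semi_norm_sharp_le[OF T])
    finally show ?thesis
      using k by (simp add: zero_le_mult_iff)
  qed
  then have "(s * sqrt u) * sqrt N \<le> 1 / 2 * sqrt N"
    by (intro mult_right_mono amgm) simp
  with row show ?thesis
    unfolding N_def by linarith
qed

end

lemma op_diag_nth: "op_diag A x $ i = A (x $ i)"
  by (simp add: op_diag_def op_matrix_def if_distribR)

lemma semi_inner_op_diag: "semi_inner (op_diag A) x y = (\<Sum>i\<in>UNIV. semi_inner A (x $ i) (y $ i))"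
  by (simp add: semi_inner_def cinner_vec_def op_diag_nth)

theorem theorem2p6:
  fixes A :: "'h::complex_hilbert_space \<Rightarrow> 'h"
    and T :: "'d::finite \<Rightarrow> 'd \<Rightarrow> 'h \<Rightarrow> 'h"
  assumes "positive_op A" and "A \<noteq> (\<lambda>x. 0)"
    and "\<And>i j. T i j \<in> ops_with_sharp A"
  shows "num_radius (op_diag A) (op_matrix T)
    \<le> (MAX i\<in>UNIV. num_radius A (T i i))
      + 1 / 2 * (\<Sum>i\<in>UNIV. sqrt (op_seminorm A
          (\<lambda>x. \<Sum>j\<in>UNIV - {i}. (T i j \<circ> sharp A (T i j)) x)))"
proof -
  interpret positive_operator A
    by (rule positive_operator.intro) fact
  define w where "w = (MAX i\<in>UNIV. num_radius A (T i i))"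
  define N where "N i = op_seminorm A (\<lambda>x. \<Sum>j\<in>UNIV - {i}. (T i j \<circ> sharp A (T i j)) x)" for i
  have norm_vec: "(\<Sum>i\<in>UNIV. (semi_norm A (x $ i))\<^sup>2) = 1" if "semi_norm (op_diag A) x = 1"
    for x :: "'h ^ 'd"
    using that by (simp add: semi_norm_def[of "op_diag A"] semi_inner_op_diag semi_inner_self)
  \<comment> \<open>the supremum of the empty set of reals is an unspecified number\<close>
  have "\<exists>x :: 'h ^ 'd. semi_norm (op_diag A) x = 1"
  proof -
    obtain v where v: "semi_norm A v = 1"
      using exists_semi_norm_1 assms(2) by blast
    have "semi_norm (op_diag A) (axis i v :: 'h ^ 'd) = 1" for i
    proof -
      have "semi_inner (op_diag A) (axis i v :: 'h ^ 'd) (axis i v)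
          = (\<Sum>j\<in>UNIV. if j = i then 1 else 0)"
        unfolding semi_inner_op_diag
        by (intro sum.cong)
          (auto simp: axis_def semi_inner_self v semi_norm_scaleR[of 0, simplified])
      then show ?thesis by (simp add: semi_norm_def)
    qed
    then show ?thesis by blast
  qed
  moreover have "cmod (semi_inner (op_diag A) (op_matrix T x) x)
      \<le> w + 1 / 2 * (\<Sum>i\<in>UNIV. sqrt (N i))" if "semi_norm (op_diag A) x = 1" for x
  proof -
    let ?D = "\<Sum>i\<in>UNIV. semi_inner A (T i i (x $ i)) (x $ i)"
    let ?R = "\<lambda>i. \<Sum>j\<in>UNIV - {i}. semi_inner A (T i j (x $ j)) (x $ i)"
    have "semi_inner (op_diag A) (op_matrix T x) x
        = (\<Sum>i\<in>UNIV. \<Sum>j\<in>UNIV. semi_inner A (T i j (x $ j)) (x $ i))"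
      by (simp add: semi_inner_op_diag op_matrix_def semi_inner_sum_left)
    also have "\<dots> = (\<Sum>i\<in>UNIV. semi_inner A (T i i (x $ i)) (x $ i) + ?R i)"
      by (intro sum.cong refl sum.remove) auto
    also have "\<dots> = ?D + (\<Sum>i\<in>UNIV. ?R i)"
      by (rule sum.distrib)
    finally have split: "semi_inner (op_diag A) (op_matrix T x) x = ?D + (\<Sum>i\<in>UNIV. ?R i)" .
    have diag: "cmod (semi_inner A (T i i (x $ i)) (x $ i)) \<le> w * (semi_norm A (x $ i))\<^sup>2" for i
    proof -
      have "linear (T i i)"
        using assms(3)[of i i] bounded_linear.linear
        by (auto simp: ops_with_sharp_def bounded_clinear_def)
      then have "cmod (semi_inner A (T i i (x $ i)) (x $ i))
          \<le> num_radius A (T i i) * (semi_norm A (x $ i))\<^sup>2"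
        using semi_norm_bounded_sharp[OF assms(3)[of i i]] semi_inner_le_num_radius by blast
      also have "\<dots> \<le> w * (semi_norm A (x $ i))\<^sup>2"
        unfolding w_def by (intro mult_right_mono Max_ge) auto
      finally show ?thesis .
    qed
    have "cmod ?D \<le> (\<Sum>i\<in>UNIV. w * (semi_norm A (x $ i))\<^sup>2)"
      by (intro sum_norm_le diag)
    also have "\<dots> = w"
      using norm_vec[OF that] by (simp add: sum_distrib_left[symmetric])
    finally have "cmod ?D \<le> w" .
    moreover have "cmod (\<Sum>i\<in>UNIV. ?R i) \<le> (\<Sum>i\<in>UNIV. 1 / 2 * sqrt (N i))"
      unfolding N_def by (intro sum_norm_le off_diagonal_row_le norm_vec that assms(3))
    ultimately show ?thesis
      unfolding split sum_distrib_left[symmetric] by (intro norm_triangle_le) simp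
  qed
  ultimately show ?thesis
    unfolding num_radius_def[of "op_diag A"] w_def[symmetric] N_def[symmetric]
    by (intro cSUP_least) auto
qed

end
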